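(* For every real number $x \geq 4$, $$\ln x = \sum_{n = 1}^{\infty} \sum_{j=0}^n \frac{1}{n} \binom{n}{j} \binom{2j}{j}\left(-\frac{1}{x}\right)^j ,$$ where the outer series over $n$ (whose $n$-th term is the finite inner sum over $j$) converges to $\ln x$.
   Context: $\ln$ denotes the natural logarithm and $\binom{n}{j}$ the usual binomial coefficient. *)

theory Defs
  imports "HOL-Analysis.Analysis"
begin

end

(*
  Put u = 4 / x, so 0 < u <= 1, and b_j = (2j choose j) / 4^j. The n-th term of the series is
  a_n(u) / n with a_n(u) = sum_j (n choose j) b_j (-u)^j. The partial sums S_N satisfy
  u S_N'(u) = a_N(u) - 1 because n (a_n - a_{n-1}) = u a_n'; hence S_N(u) + ln u - S_N(1) tends
  to 0 as soon as a_N tends to 0 uniformly on [u, 1].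
  Vandermonde's identity gives a_n(1) = b_n, and this self-duality turns a_n(u) into the Bernstein
  polynomial sum_j (n choose j) u^j (1-u)^(n-j) b_j, which is nonnegative and, since
  b_j^2 <= 1 / (j + 1), at most 1 / sqrt ((n + 1) u) by Cauchy-Schwarz.
  It remains to see S_N(1) = sum_{n <= N} b_n / n --> ln 4. Integrating the binomial series of
  (1 - z)^(-1/2) gives sum_n b_n z^n / n = ln 4 - 2 ln (1 + sqrt (1 - z)) for 0 < z < 1, and z --> 1
  is harmless because all terms are nonnegative.
*)

theory Submission
  imports Defs
begin

section \<open>Central binomial ratios: size and self-duality\<close>

definition central_ratio :: "nat \<Rightarrow> real" where
  "central_ratio j = real ((2 * j) choose j) / 4 ^ j"

lemma central_ratio_0 [simp]: "central_ratio 0 = 1"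
  by (simp add: central_ratio_def)

lemma central_ratio_nonneg: "0 \<le> central_ratio j"
  by (simp add: central_ratio_def)

lemma central_ratio_Suc:
  "central_ratio (Suc n) = central_ratio n * (2 * real n + 1) / (2 * real n + 2)"
proof -
  have eq: "central_ratio m = fact (2 * m) / (fact m * fact m * 4 ^ m)" for m
    by (simp add: central_ratio_def binomial_fact mult_2)
  have "fact (2 * Suc n) = (2 * real n + 2) * (2 * real n + 1) * (fact (2 * n) :: real)"
    by (simp add: algebra_simps)
  then show ?thesis
    unfolding eq by (simp add: divide_simps) (simp add: algebra_simps)
qed

text \<open>Makes both Vandermonde's identity and the binomial series of exponent -1/2 available for
  \<open>central_ratio\<close>.\<close>

lemma gbinomial_minus_half: "(- (1 / 2) :: real) gchoose n = (-1) ^ n * central_ratio n"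
proof (induction n)
  case (Suc n)
  have "real (Suc n) * (- (1 / 2) gchoose Suc n) = (- (1 / 2) - real n) * (- (1 / 2) gchoose n)"
    using gbinomial_mult_1[of "- (1 / 2) :: real" n] by (simp add: algebra_simps)
  then show ?case
    unfolding Suc.IH central_ratio_Suc by (simp add: field_simps)
qed simp

text \<open>By induction; the step amounts to ((2j+1)/(2j+2))^2 \<le> (j+1)/(j+2). The bound 1/(j+1)
  has the form that can be averaged exactly against Bernstein weights.\<close>

lemma central_ratio_square_le: "(central_ratio j)\<^sup>2 \<le> 1 / (real j + 1)"
proof (induction j)
  case (Suc j)
  have "(central_ratio (Suc j))\<^sup>2 = (central_ratio j)\<^sup>2 * ((2 * real j + 1) / (2 * real j + 2))\<^sup>2"
    by (simp add: central_ratio_Suc power_mult_distrib power_divide)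
  also have "\<dots> \<le> 1 / (real j + 1) * ((2 * real j + 1) / (2 * real j + 2))\<^sup>2"
    by (rule mult_right_mono[OF Suc.IH]) simp
  also have "\<dots> \<le> 1 / (real (Suc j) + 1)"
  proof -
    have "(2 * real j + 1)\<^sup>2 * (real j + 2) \<le> (real j + 1) * (2 * real j + 2)\<^sup>2"
      by (simp add: algebra_simps power2_eq_square)
    then show ?thesis
      by (simp add: divide_simps add.commute)
  qed
  finally show ?case .
qed simp

text \<open>The sum is a Vandermonde convolution with upper indices -1/2 and n. Negating the upper
  index n - 1/2 of the result leads back to -1/2, since n - (n - 1/2) - 1 = -1/2.\<close>

lemma central_ratio_self_dual:
  "(\<Sum>j\<le>n. real (n choose j) * central_ratio j * (-1) ^ j) = central_ratio n"
proof -
  have "(\<Sum>j\<le>n. real (n choose j) * central_ratio j * (-1) ^ j)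
      = (\<Sum>j\<le>n. (- (1 / 2) gchoose j) * (real n gchoose (n - j)))"
    by (intro sum.cong)
       (auto simp: gbinomial_minus_half binomial_symmetric[symmetric] simp flip: binomial_gbinomial)
  also have "\<dots> = (- (1 / 2) + real n) gchoose n"
    by (simp add: gbinomial_Vandermonde atMost_atLeast0)
  also have "\<dots> = (-1) ^ n * (- (1 / 2) gchoose n)"
    using gbinomial_negated_upper[of "- (1 / 2) + real n" n] by simp
  also have "\<dots> = central_ratio n"
    by (simp add: gbinomial_minus_half flip: power_mult_distrib mult.assoc)
  finally show ?thesis .
qed

section \<open>The polynomials \<open>central_sum\<close>: Bernstein form and uniform decay\<close>

definition central_sum :: "nat \<Rightarrow> real \<Rightarrow> real" where
  "central_sum n u = (\<Sum>j\<le>n. real (n choose j) * central_ratio j * (- u) ^ j)"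

lemma central_sum_1: "central_sum n 1 = central_ratio n"
  by (simp add: central_sum_def central_ratio_self_dual)

text \<open>Expand each \<open>central_ratio j\<close> on the right by self-duality and exchange the
  sums; the inner sum becomes (u + (1 - u))^(n - i) = 1. The alternating sum thus turns into an
  average with nonnegative weights for u in [0, 1].\<close>

lemma central_sum_eq_Bernstein:
  "central_sum n u = (\<Sum>j\<le>n. Bernstein n j u * central_ratio j)"
proof -
  have "(\<Sum>j\<le>n. Bernstein n j u * central_ratio j)
      = (\<Sum>j\<le>n. \<Sum>i\<le>j. real (n choose j) * u ^ j * (1 - u) ^ (n - j)
           * (real (j choose i) * central_ratio i * (-1) ^ i))"
    by (simp add: Bernstein_def central_ratio_self_dual flip: sum_distrib_left)
  also have "\<dots> = (\<Sum>i\<le>n. \<Sum>j=i..n. real (n choose j) * u ^ j * (1 - u) ^ (n - j)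
           * (real (j choose i) * central_ratio i * (-1) ^ i))"
    by (subst (1 2) sum.Sigma, simp_all, rule sum.reindex_bij_witness[where i = prod.swap and j = prod.swap])
       auto
  also have "\<dots> = (\<Sum>i\<le>n. real (n choose i) * central_ratio i * (- u) ^ i)"
  proof (rule sum.cong[OF refl])
    fix i assume "i \<in> {..n}"
    then have i: "i \<le> n" by simp
    have "(\<Sum>j=i..n. real (n choose j) * u ^ j * (1 - u) ^ (n - j)
           * (real (j choose i) * central_ratio i * (-1) ^ i))
        = (\<Sum>j=i..n. real (n choose i) * central_ratio i * (- u) ^ i *
            (real ((n - i) choose (j - i)) * u ^ (j - i) * (1 - u) ^ (n - j)))"
    proof (rule sum.cong[OF refl])
      fix j assume j: "j \<in> {i..n}"
      \<comment> \<open>Pulls the factors depending only on \<open>i\<close> out of the sum over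
        \<open>j\<close>.\<close>
      then have "real (n choose j) * real (j choose i) = real (n choose i) * real ((n - i) choose (j - i))"
        using choose_mult[of i j n] by (simp flip: of_nat_mult)
      moreover have "u ^ j = u ^ i * u ^ (j - i)"
        using j by (simp flip: power_add)
      moreover have "(- u) ^ i = (-1) ^ i * u ^ i"
        by (rule power_minus)
      moreover have "real (n choose j) * u ^ j * (1 - u) ^ (n - j)
           * (real (j choose i) * central_ratio i * (-1) ^ i)
          = (real (n choose j) * real (j choose i)) * u ^ j * (1 - u) ^ (n - j)
             * (central_ratio i * (-1) ^ i)"
        by (simp only: mult_ac)
      ultimately show "real (n choose j) * u ^ j * (1 - u) ^ (n - j)
           * (real (j choose i) * central_ratio i * (-1) ^ i)
          = real (n choose i) * central_ratio i * (- u) ^ i *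
            (real ((n - i) choose (j - i)) * u ^ (j - i) * (1 - u) ^ (n - j))"
        by (simp only: mult_ac)
    qed
    also have "\<dots> = real (n choose i) * central_ratio i * (- u) ^ i *
        (\<Sum>j=i..n. real ((n - i) choose (j - i)) * u ^ (j - i) * (1 - u) ^ (n - j))"
      by (simp add: sum_distrib_left)
    also have "(\<Sum>j=i..n. real ((n - i) choose (j - i)) * u ^ (j - i) * (1 - u) ^ (n - j))
        = (\<Sum>k\<le>n - i. real ((n - i) choose k) * u ^ k * (1 - u) ^ (n - i - k))"
      by (rule sum.reindex_bij_witness[where i = "\<lambda>k. k + i" and j = "\<lambda>j. j - i"]) (use i in auto)
    also have "\<dots> = 1"
      using binomial_ring[of u "1 - u" "n - i"] by simp
    finally show "(\<Sum>j=i..n. real (n choose j) * u ^ j * (1 - u) ^ (n - j)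
           * (real (j choose i) * central_ratio i * (-1) ^ i))
        = real (n choose i) * central_ratio i * (- u) ^ i" by simp
  qed
  finally show ?thesis by (simp add: central_sum_def)
qed

text \<open>Absorbing 1/(j+1) into the binomial coefficient raises degree and index by one, at the
  price of the factor 1/((n+1)u). The Bernstein polynomials of degree n+1 sum to 1, and only the one
  of index 0, (1 - u)^(n+1), is missing.\<close>

lemma sum_Bernstein_divide_Suc:
  assumes "u \<noteq> 0"
  shows "(\<Sum>j\<le>n. Bernstein n j u / (real j + 1)) = (1 - (1 - u) ^ Suc n) / ((real n + 1) * u)"
proof -
  have "1 = (\<Sum>j\<le>Suc n. Bernstein (Suc n) j u)"
    by simp
  also have "\<dots> = (1 - u) ^ Suc n + (\<Sum>j\<le>n. Bernstein (Suc n) (Suc j) u)"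
    by (subst sum.atMost_Suc_shift) (simp add: Bernstein_def)
  also have "(\<Sum>j\<le>n. Bernstein (Suc n) (Suc j) u)
      = (\<Sum>j\<le>n. (real n + 1) * u * (Bernstein n j u / (real j + 1)))"
  proof (rule sum.cong[OF refl])
    fix j
    have "real (Suc j) * real (Suc n choose Suc j) = real (Suc n) * real (n choose j)"
      using Suc_times_binomial_eq[of n j] by (simp only: flip: of_nat_mult) (simp add: mult.commute)
    then have "real (Suc n choose Suc j) = (real n + 1) * real (n choose j) / (real j + 1)"
      by (simp add: field_simps)
    then show "Bernstein (Suc n) (Suc j) u = (real n + 1) * u * (Bernstein n j u / (real j + 1))"
      unfolding Bernstein_def by simp
  qed
  finally have "(real n + 1) * u * (\<Sum>j\<le>n. Bernstein n j u / (real j + 1)) = 1 - (1 - u) ^ Suc n"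
    unfolding sum_distrib_left by linarith
  then show ?thesis
    using assms by (subst eq_divide_eq) (simp add: mult.commute)
qed

lemma central_sum_nonneg: "0 \<le> u \<Longrightarrow> u \<le> 1 \<Longrightarrow> 0 \<le> central_sum n u"
  unfolding central_sum_eq_Bernstein
  by (intro sum_nonneg mult_nonneg_nonneg Bernstein_nonneg central_ratio_nonneg)

text \<open>The Bernstein weights sum to 1, so by Cauchy-Schwarz the squared average of the ratios
  is at most the average of their squares.\<close>

lemma central_sum_le:
  assumes "0 < u" "u \<le> 1"
  shows "central_sum n u \<le> 1 / sqrt ((real n + 1) * u)"
proof -
  have nonneg: "0 \<le> Bernstein n j u" for j
    using assms by (simp add: Bernstein_nonneg)
  \<comment> \<open>Each weight is split into two square roots, one for each Cauchy-Schwarz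
    factor.\<close>
  have "(central_sum n u)\<^sup>2
      = (\<Sum>j\<le>n. sqrt (Bernstein n j u) * (sqrt (Bernstein n j u) * central_ratio j))\<^sup>2"
    unfolding central_sum_eq_Bernstein by (simp add: nonneg flip: mult.assoc)
  also have "\<dots> \<le> (\<Sum>j\<le>n. (sqrt (Bernstein n j u))\<^sup>2)
      * (\<Sum>j\<le>n. (sqrt (Bernstein n j u) * central_ratio j)\<^sup>2)"
    by (rule Cauchy_Schwarz_ineq_sum)
  also have "\<dots> = (\<Sum>j\<le>n. Bernstein n j u * (central_ratio j)\<^sup>2)"
    by (simp add: nonneg power_mult_distrib)
  also have "\<dots> \<le> (\<Sum>j\<le>n. Bernstein n j u * (1 / (real j + 1)))"
    by (intro sum_mono mult_left_mono central_ratio_square_le nonneg)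
  also have "\<dots> = (1 - (1 - u) ^ Suc n) / ((real n + 1) * u)"
    using sum_Bernstein_divide_Suc[of u n] assms by simp
  also have "\<dots> \<le> 1 / ((real n + 1) * u)"
    using assms by (intro divide_right_mono) simp_all
  finally have "\<bar>central_sum n u\<bar> \<le> sqrt (1 / ((real n + 1) * u))"
    by (rule real_le_rsqrt[of "\<bar>_\<bar>", simplified])
  then show ?thesis
    by (simp add: real_sqrt_divide)
qed

section \<open>Derivatives of the partial sums and comparison with the point u = 1\<close>

lemma has_real_derivative_central_sum_Suc:
  assumes "u \<noteq> 0"
  shows "(central_sum (Suc n) has_real_derivative
           real (Suc n) * (central_sum (Suc n) u - central_sum n u) / u) (at u)"
proof -
  let ?c = "\<lambda>j. real (Suc n choose j) * central_ratio j"
  \<comment> \<open>Taking the difference in \<open>n\<close> thus multiplies the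
    \<open>j\<close>-th coefficient by \<open>j\<close>, exactly as u d/du does.\<close>
  have choose: "real (Suc n) * (real (Suc n choose j) - real (n choose j)) = real j * real (Suc n choose j)" for j
  proof (cases j)
    case (Suc k)
    have "real (Suc k) * real (Suc n choose Suc k) = real (Suc n) * real (n choose k)"
      using Suc_times_binomial_eq[of n k] by (simp only: flip: of_nat_mult) (simp add: mult.commute)
    then show ?thesis by (simp add: Suc)
  qed simp
  have power: "real j * (- u) ^ (j - 1) * u = - (real j * (- u) ^ j)" for j
    by (cases j) simp_all
  \<comment> \<open>The added top term vanishes because \<open>n choose Suc n\<close> is 0; both
    sums now share one range.\<close>
  have "central_sum n u = (\<Sum>j\<le>Suc n. real (n choose j) * central_ratio j * (- u) ^ j)"
    by (simp add: central_sum_def)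
  then have "real (Suc n) * (central_sum (Suc n) u - central_sum n u)
      = (\<Sum>j\<le>Suc n. real (Suc n) * (real (Suc n choose j) - real (n choose j))
           * (central_ratio j * (- u) ^ j))"
    unfolding central_sum_def by (simp only: sum_distrib_left flip: sum_subtractf) (simp add: algebra_simps)
  also have "\<dots> = (\<Sum>j\<le>Suc n. ?c j * (real j * (- u) ^ j))"
    unfolding choose by (rule sum.cong) (simp_all add: mult_ac)
  also have "\<dots> = (\<Sum>j\<le>Suc n. ?c j * (real j * (- u) ^ (j - 1) * - 1)) * u"
    unfolding sum_distrib_right
  proof (rule sum.cong[OF refl])
    fix j
    show "?c j * (real j * (- u) ^ j) = ?c j * (real j * (- u) ^ (j - 1) * - 1) * u"
      using arg_cong[OF power[of j], of "\<lambda>y. ?c j * y"] by (simp only: mult_ac) simp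
  qed
  finally have eq: "(\<Sum>j\<le>Suc n. ?c j * (real j * (- u) ^ (j - 1) * - 1))
      = real (Suc n) * (central_sum (Suc n) u - central_sum n u) / u"
    using assms by simp
  have "((\<lambda>u. \<Sum>j\<le>Suc n. ?c j * (- u) ^ j) has_real_derivative
      (\<Sum>j\<le>Suc n. ?c j * (real j * (- u) ^ (j - 1) * - 1))) (at u)"
    by (rule DERIV_sum) (auto intro!: derivative_eq_intros)
  then show ?thesis
    unfolding eq by (simp add: central_sum_def[abs_def])
qed

definition log_sum :: "nat \<Rightarrow> real \<Rightarrow> real" where
  "log_sum N u = (\<Sum>n<N. central_sum (Suc n) u / real (Suc n))"

text \<open>The division by \<open>Suc n\<close> cancels the factor in the derivative of each term,
  and the differences telescope down to \<open>central_sum 0 u = 1\<close>.\<close>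

lemma has_real_derivative_log_sum:
  assumes "u \<noteq> 0"
  shows "(log_sum N has_real_derivative (central_sum N u - 1) / u) (at u)"
proof -
  have "((\<lambda>u. \<Sum>n<N. central_sum (Suc n) u / real (Suc n)) has_real_derivative
      (\<Sum>n<N. real (Suc n) * (central_sum (Suc n) u - central_sum n u) / u / real (Suc n))) (at u)"
    by (intro DERIV_sum DERIV_cdivide has_real_derivative_central_sum_Suc assms)
  moreover have "(\<Sum>n<N. real (Suc n) * (central_sum (Suc n) u - central_sum n u) / u / real (Suc n))
      = (\<Sum>n<N. central_sum (Suc n) u - central_sum n u) / u"
    unfolding sum_divide_distrib by (rule sum.cong) (simp_all del: of_nat_Suc)
  moreover have "(\<Sum>n<N. central_sum (Suc n) u - central_sum n u) = central_sum N u - 1"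
    by (subst sum_lessThan_telescope) (simp add: central_sum_def)
  ultimately show ?thesis
    by (simp add: log_sum_def[abs_def])
qed

text \<open>Adding \<open>ln\<close> cancels the -1/v in the derivative. What remains,
  \<open>central_sum N v / v\<close>, tends to 0 uniformly on [u, 1], so the mean value theorem
  applies.\<close>

lemma log_sum_diff_tendsto:
  assumes "0 < u" "u \<le> 1"
  shows "(\<lambda>N. log_sum N u + ln u - log_sum N 1) \<longlonglongrightarrow> 0"
proof (cases "u = 1")
  case False
  then have u: "u < 1" using assms by simp
  have "\<bar>log_sum N u + ln u - log_sum N 1\<bar> \<le> 1 / sqrt ((real N + 1) * u) / u" for N
  proof -
    have "((\<lambda>v. log_sum N v + ln v) has_real_derivative central_sum N v / v) (at v)" if "u \<le> v" for v
      using that assms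
      by (auto intro!: derivative_eq_intros has_real_derivative_log_sum simp: diff_divide_distrib)
    from MVT2[OF u this] obtain v where v: "u < v" "v < 1"
      and eq: "log_sum N 1 - (log_sum N u + ln u) = (1 - u) * (central_sum N v / v)"
      by auto
    \<comment> \<open>The bound at \<open>v\<close> is weakened to the one at \<open>u < v\<close>,
      so that it does not depend on the intermediate point, which varies with
      \<open>N\<close>.\<close>
    have "central_sum N v \<le> 1 / sqrt ((real N + 1) * u)"
      using assms v
      by (intro order_trans[OF central_sum_le]) (auto intro!: divide_left_mono mult_left_mono)
    then have "central_sum N v / v \<le> 1 / sqrt ((real N + 1) * u) / u"
      using assms v by (intro frac_le) simp_all
    moreover have "0 \<le> central_sum N v / v"
      using assms v by (intro divide_nonneg_pos central_sum_nonneg) simp_all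
    moreover have "(1 - u) * (central_sum N v / v) \<le> central_sum N v / v"
      using \<open>0 \<le> central_sum N v / v\<close> assms by (intro mult_left_le_one_le) simp_all
    moreover have "0 \<le> (1 - u) * (central_sum N v / v)"
      using \<open>0 \<le> central_sum N v / v\<close> assms by (intro mult_nonneg_nonneg) simp_all
    moreover have "\<bar>log_sum N u + ln u - log_sum N 1\<bar> = \<bar>log_sum N 1 - (log_sum N u + ln u)\<bar>"
      by (rule abs_minus_commute)
    ultimately show ?thesis
      unfolding eq by simp
  qed
  moreover have "(\<lambda>N. 1 / sqrt ((real N + 1) * u) / u) \<longlonglongrightarrow> 0"
  proof -
    have "(\<lambda>N. sqrt (inverse (real (Suc N))) * (1 / sqrt u / u)) \<longlonglongrightarrow> sqrt 0 * (1 / sqrt u / u)"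
      by (intro tendsto_intros LIMSEQ_inverse_real_of_nat)
    then show ?thesis
      by (simp add: real_sqrt_mult real_sqrt_inverse divide_inverse add.commute mult.assoc)
  qed
  ultimately show ?thesis
    by (intro Lim_null_comparison[of "\<lambda>N. log_sum N u + ln u - log_sum N 1"] always_eventually allI)
       (simp_all only: real_norm_def)
qed simp

section \<open>Generating functions and the value of the series at u = 1\<close>

lemma central_ratio_powser:
  assumes "\<bar>z\<bar> < 1"
  shows "(\<lambda>n. central_ratio n * z ^ n) sums (1 / sqrt (1 - z))"
proof -
  have "(\<lambda>n. ((- (1 / 2)) gchoose n) * (- z) ^ n) sums (1 + - z) powr (- (1 / 2))"
    by (rule gen_binomial_real) (use assms in simp)
  moreover have "((- (1 / 2)) gchoose n) * (- z) ^ n = central_ratio n * z ^ n" for n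
    by (cases "even n") (simp_all add: gbinomial_minus_half)
  ultimately show ?thesis
    using assms by (simp add: powr_minus powr_half_sqrt inverse_eq_divide)
qed

text \<open>Drop the constant term of the previous series and divide by z = (1 - s)(1 + s), where s
  = sqrt (1 - z). The cancelled form of the limit is also valid at z = 0, where it is 1/2.\<close>

lemma central_ratio_Suc_powser:
  assumes "\<bar>z\<bar> < 1"
  shows "(\<lambda>n. central_ratio (Suc n) * z ^ n) sums (1 / (sqrt (1 - z) * (1 + sqrt (1 - z))))"
proof (cases "z = 0")
  case True
  then show ?thesis
    using powser_sums_zero[of "\<lambda>n. central_ratio (Suc n)"] by (simp add: central_ratio_Suc)
next
  case False
  define s where "s = sqrt (1 - z)"
  have s: "0 < s" "s * s = 1 - z"
    using assms by (simp_all add: s_def)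
  have "(\<lambda>n. central_ratio (Suc n) * z ^ Suc n) sums (1 / s - 1)"
    using central_ratio_powser[OF assms] by (subst sums_Suc_iff) (simp add: s_def)
  then have "(\<lambda>n. central_ratio (Suc n) * z ^ Suc n / z) sums ((1 / s - 1) / z)"
    by (rule sums_divide)
  moreover have "(1 / s - 1) / z = 1 / (s * (1 + s))"
    using s False by (simp add: divide_simps add_eq_0_iff) (simp add: algebra_simps)
  ultimately show ?thesis
    using False by (simp add: s_def)
qed

text \<open>Termwise differentiation gives the previous series, which is also the derivative of -2
  ln (1 + sqrt (1 - t)). The two functions differ by a constant, found at t = 0 to be 2 ln 2 = ln
  4.\<close>

lemma central_ratio_log_powser:
  assumes "0 < z" "z < 1"
  shows "(\<lambda>n. central_ratio (Suc n) / real (Suc n) * z ^ Suc n) sums (ln 4 - 2 * ln (1 + sqrt (1 - z)))"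
proof -
  let ?f = "\<lambda>n. central_ratio (Suc n) / real (Suc n)"
  let ?G = "\<lambda>z. \<Sum>n. ?f n * z ^ Suc n"
  have G: "(?G has_real_derivative 1 / (sqrt (1 - t) * (1 + sqrt (1 - t)))) (at t)" if "\<bar>t\<bar> < 1" for t
  proof -
    have sums: "(\<lambda>n. ?f n * real (Suc n) * t ^ n) sums (1 / (sqrt (1 - t) * (1 + sqrt (1 - t))))"
      if "\<bar>t\<bar> < 1" for t
      using central_ratio_Suc_powser[OF that] by (simp del: of_nat_Suc)
    have "(?G has_real_derivative (\<Sum>n. ?f n * real (Suc n) * t ^ n)) (at t)"
      by (rule DERIV_power_series'[where R = 1]) (use that in \<open>auto intro!: sums_summable[OF sums] simp del: of_nat_Suc times_divide_eq_left\<close>)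
    then show ?thesis
      using sums_unique[OF sums[OF that]] by simp
  qed
  have H: "((\<lambda>t. - 2 * ln (1 + sqrt (1 - t))) has_real_derivative
      1 / (sqrt (1 - t) * (1 + sqrt (1 - t)))) (at t)" if "\<bar>t\<bar> < 1" for t
  proof -
    have "0 < 1 + sqrt (1 - t)"
      using that by (intro add_pos_nonneg) simp_all
    then have "((\<lambda>t. - 2 * ln (1 + sqrt (1 - t))) has_real_derivative
        - 2 * (1 / (1 + sqrt (1 - t)) * (inverse (sqrt (1 - t)) / 2 * - 1))) (at t)"
      using that by (auto intro!: derivative_eq_intros)
    moreover have "- 2 * (1 / (1 + sqrt (1 - t)) * (inverse (sqrt (1 - t)) / 2 * - 1))
        = 1 / (sqrt (1 - t) * (1 + sqrt (1 - t)))"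
      by (simp add: inverse_eq_divide mult.commute)
    ultimately show ?thesis
      by (simp only:)
  qed
  have "((\<lambda>t. ?G t - - 2 * ln (1 + sqrt (1 - t))) has_real_derivative 0) (at t)" if "\<bar>t\<bar> < 1" for t
    using DERIV_diff[OF G[OF that] H[OF that]] by (simp only: diff_self)
  then have "?G z - - 2 * ln (1 + sqrt (1 - z)) = ?G 0 - - 2 * ln (1 + sqrt (1 - 0))"
    by (intro DERIV_isconst3[of "-1" 1]) (use assms in auto)
  also have "\<dots> = ln 4"
    using ln_realpow[of 2 2] by simp
  finally have "?G z = ln 4 - 2 * ln (1 + sqrt (1 - z))" by simp
  \<comment> \<open>The value of \<open>?G z\<close> is that of a \<open>suminf\<close>, so
    convergence is established separately, by comparison with the series of 1 / sqrt (1 -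
    z).\<close>
  moreover have "summable (\<lambda>n. ?f n * z ^ Suc n)"
  proof (rule summable_comparison_test')
    show "summable (\<lambda>n. central_ratio (Suc n) * z ^ Suc n)"
      using sums_summable[OF central_ratio_powser[of z]] assms
      by (subst summable_Suc_iff) auto
    fix n
    have le: "?f n \<le> central_ratio (Suc n) / 1"
      by (intro divide_left_mono) (simp_all add: central_ratio_nonneg)
    show "norm (?f n * z ^ Suc n) \<le> central_ratio (Suc n) * z ^ Suc n"
      using assms mult_right_mono[OF le, of "z ^ Suc n"]
      by (simp add: abs_mult central_ratio_nonneg del: power_Suc of_nat_Suc)
  qed
  ultimately show ?thesis
    by (simp add: sums_iff)
qed

text \<open>Abel's limit by monotonicity: letting z tend to 1 in finite sums bounds the partial sums
  by ln 4, which gives convergence. Conversely, each term is at least its value with the factor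
  z^(n+1), so the limit z to 1 bounds the total below by ln 4.\<close>

lemma central_ratio_log_sums: "(\<lambda>n. central_ratio (Suc n) / real (Suc n)) sums ln 4"
proof -
  let ?f = "\<lambda>n. central_ratio (Suc n) / real (Suc n)"
  have f: "0 \<le> ?f n" for n
    by (simp add: central_ratio_nonneg)
  have partial: "(\<Sum>n<N. ?f n) \<le> ln 4" for N
  proof (rule tendsto_upperbound)
    show "((\<lambda>z. \<Sum>n<N. ?f n * z ^ Suc n) \<longlongrightarrow> (\<Sum>n<N. ?f n)) (at_left 1)"
      by (auto intro!: tendsto_eq_intros)
    show "\<forall>\<^sub>F z in at_left 1. (\<Sum>n<N. ?f n * z ^ Suc n) \<le> ln 4"
      using eventually_at_left_real[of 0 "1::real"]
    proof (rule eventually_mono)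
      fix z :: real assume z: "z \<in> {0<..<1}"
      have "(\<Sum>n<N. ?f n * z ^ Suc n) \<le> ln 4 - 2 * ln (1 + sqrt (1 - z))"
        using z f central_ratio_log_powser[of z] sum_le_suminf[of "\<lambda>n. ?f n * z ^ Suc n" "{..<N}"]
        by (simp add: sums_iff central_ratio_nonneg)
      also have "\<dots> \<le> ln 4"
        using z by simp
      finally show "(\<Sum>n<N. ?f n * z ^ Suc n) \<le> ln 4" .
    qed simp
  qed simp
  have summable: "summable ?f"
    by (rule summableI_nonneg_bounded[OF f partial])
  have "ln 4 \<le> suminf ?f"
  proof (rule tendsto_upperbound)
    show "((\<lambda>z. ln 4 - 2 * ln (1 + sqrt (1 - z))) \<longlongrightarrow> ln (4::real)) (at_left 1)"
      by (auto intro!: tendsto_eq_intros)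
    show "\<forall>\<^sub>F z in at_left 1. ln 4 - 2 * ln (1 + sqrt (1 - z)) \<le> suminf ?f"
      using eventually_at_left_real[of 0 "1::real"]
    proof (rule eventually_mono)
      fix z :: real assume z: "z \<in> {0<..<1}"
      have "?f n * z ^ Suc n \<le> ?f n" for n
        using z f[of n] by (intro mult_left_le power_le_one) auto
      then show "ln 4 - 2 * ln (1 + sqrt (1 - z)) \<le> suminf ?f"
        using z by (intro sums_le[OF _ central_ratio_log_powser summable_sums[OF summable]]) auto
    qed simp
  qed simp
  moreover have "suminf ?f \<le> ln 4"
    by (rule suminf_le_const[OF summable partial])
  ultimately show ?thesis
    using summable by (simp add: sums_iff)
qed

section \<open>Return from u to x\<close>

theorem theorem2p1:
  fixes x :: real
  assumes "x \<ge> 4"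
  shows "(\<lambda>m. \<Sum>j=0..Suc m. 1 / real (Suc m) * real (Suc m choose j)
            * real ((2 * j) choose j) * (- (1 / x)) ^ j) sums ln x"
proof -
  \<comment> \<open>The 4 compensates the 4^j in \<open>central_ratio\<close>; the hypothesis on
    \<open>x\<close> becomes u \<le> 1.\<close>
  define u where "u = 4 / x"
  have u: "0 < u" "u \<le> 1"
    using assms by (simp_all add: u_def)
  have "(\<Sum>j=0..Suc m. 1 / real (Suc m) * real (Suc m choose j)
            * real ((2 * j) choose j) * (- (1 / x)) ^ j) = central_sum (Suc m) u / real (Suc m)" for m
  proof -
    have "- u = 4 * (- (1 / x))"
      by (simp add: u_def)
    then have "central_ratio j * (- u) ^ j = real ((2 * j) choose j) * (- (1 / x)) ^ j" for j
      by (simp only: power_mult_distrib) (simp add: central_ratio_def)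
    then show ?thesis
      unfolding central_sum_def sum_divide_distrib atMost_atLeast0
      by (intro sum.cong) (simp_all add: mult.assoc del: of_nat_Suc binomial_Suc_Suc)
  qed
  moreover have "(\<lambda>N. log_sum N u) \<longlonglongrightarrow> ln x"
  proof -
    have "(\<lambda>N. log_sum N 1) \<longlonglongrightarrow> ln 4"
      using central_ratio_log_sums by (simp add: sums_def log_sum_def central_sum_1)
    \<comment> \<open>Adds the limits of \<open>log_sum N u + ln u - log_sum N 1\<close> and of
      \<open>log_sum N 1 - ln u\<close>.\<close>
    from tendsto_add[OF log_sum_diff_tendsto[OF u] tendsto_diff[OF this tendsto_const[of "ln u"]]]
    have "(\<lambda>N. log_sum N u) \<longlonglongrightarrow> ln 4 - ln u"
      by simp
    moreover have "ln 4 - ln u = ln x"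
      using assms by (simp add: u_def ln_div)
    ultimately show ?thesis by simp
  qed
  ultimately show ?thesis
    by (simp add: sums_def log_sum_def)
qed

end
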